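(* Let $K$ be an algebraically closed field, $A\in\mathcal{A}(m,\Gamma)$, $\{1,f_\gamma=x^\gamma u_\gamma\mid\gamma\in\Gamma\}$ the canonical basis of the algebra $\overline{A}=A/x^mK[x]$, and $\operatorname{ind}(\Gamma)=\{\nu_1,\ldots,\nu_s\}$. Then: 1. $\operatorname{Aut}_K(A)=\{t_\lambda\in\mathbb{T}\mid t_\lambda(f_\gamma)=\lambda^\gamma f_\gamma\text{ for all }\gamma\in\Gamma\}=\{t_\lambda\in\mathbb{T}\mid t_\lambda(u_\gamma)=u_\gamma\text{ for all }\gamma\in\Gamma\}$. 2. $\operatorname{Aut}_K(A)=\mathbb{T}$ iff $f_\gamma=x^\gamma$ for all $\gamma\in\Gamma$. 3. Suppose that $f_\gamma\neq x^\gamma$ for some $\gamma\in\Gamma$. Then $\operatorname{Aut}_K(A)=C_n=\langle t_{\lambda_n}\rangle$ is a cyclic group of order $n$, where $n=\gcd(A)$ if $\operatorname{char}(K)=0$ and $n=\gcd(A)_p$ if $\operatorname{char}(K)=p>0$, and $\lambda_n$ is a primitive $n$-th root of unity. Moreover: (a) if $\operatorname{char}(K)=0$ then $\gcd(A)=\gcd\{\gcd(u_{\nu_i})\mid i=1,\ldots,s\}$; (b) if $\operatorname{char}(K)=p>0$ then $\gcd(A)_p=\gcd\{\gcd_p(u_{\nu_i})\mid i=1,\ldots,s\}$. 4. $\operatorname{Aut}_K(A)=\{e\}$ iff $\gcd(A)=1$ if $\operatorname{char}(K)=0$, or $\gcd_p(A)=1$ if $\operatorname{char}(K)=p>0$.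
   Context: $\mathbb{S}(m)$ is the set consisting of the empty set and of all non-empty subsets $\Gamma\subseteq\{2,\ldots,m-2\}$ such that $\Gamma+\Gamma\subseteq\Gamma\cup[m,\infty)$. An element of $\Gamma$ is decomposable if it is a sum of two elements of $\Gamma$; $\operatorname{ind}(\Gamma)$ is the set of elements of $\Gamma$ that are not decomposable. $\mathcal{A}(m)$ ($m\geq2$) is the set of all $K$-subalgebras $A$ of $K[x]$ such that $x^mK[x]\subset A$ and $x^{m-1}\notin A$. For $A\in\mathcal{A}(m)$, $\Gamma_A\in\mathbb{S}(m)$ is the set of integers $\gamma$ with $1\leq\gamma\leq m-1$ such that $A$ contains an element of the form $x^\gamma+\sum_{j>\gamma}\lambda_jx^j$. $\mathcal{A}(m,\Gamma):=\{A\in\mathcal{A}(m)\mid\Gamma_A=\Gamma\}$. The algebra $\overline{A}:=A/x^mK[x]\subseteq K[x]/x^mK[x]=\bigoplus_{i=0}^{m-1}Kx^i$ has a unique $K$-basis $\{1,f_\gamma\mid\gamma\in\Gamma\}$ (the canonical basis) with $f_\gamma=x^\gamma+\sum_{\delta\in C\Gamma(\gamma)}\lambda_{\gamma\delta}x^\delta$, $\lambda_{\gamma\delta}\in K$, $C\Gamma(\gamma)=\{\delta\mid\delta\notin\Gamma,\gamma<\delta\leq m-1\}$. One writes $f_\gamma=x^\gamma u_\gamma$ with $u_\gamma:=1+\sum_{\delta\in C\Gamma(\gamma)}\lambda_{\gamma\delta}x^{\delta-\gamma}\in K[x]$. $\mathbb{T}=\{t_\lambda\mid\lambda\in K^\times\}$,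 where $t_\lambda$ is the automorphism $x\mapsto\lambda x$ of $K[x]$ (and the induced one of $K[x]/x^mK[x]$). $\operatorname{Aut}_K(A)$ is the group of $K$-algebra automorphisms of $A$; an element $t_\lambda$ with $t_\lambda(A)=A$ is identified with its restriction to $A$. For a polynomial $u=\sum_ia_ix^i$, $\gcd(u):=\gcd\{i\geq 1\mid a_i\neq 0\}$, with the convention $\gcd(\emptyset)=0$ (so $\gcd(1)=0$). For a prime $p$ and an integer $n\geq 1$, write $n=p^kn_p$ with $p\nmid n_p$; $n_p$ is the $p$-co-prime divisor of $n$ (and $0_p:=0$). $\gcd_p(u):=\gcd(u)_p$. $\gcd(A):=\gcd(\overline{A}):=\gcd\{\gcd(u_\gamma)\mid\gamma\in\Gamma\}$ and $\gcd_p(A):=\gcd\{\gcd_p(u_\gamma)\mid\gamma\in\Gamma\}=\gcd(A)_p$. *)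

theory Defs
  imports
    "HOL-Algebra.Bij"
    "HOL-Algebra.Elementary_Groups"
    "HOL-Computational_Algebra.Computational_Algebra"
begin

hide_const (open) Polynomial.order

interpretation poly_vs: vector_space "smult :: 'a::field \<Rightarrow> 'a poly \<Rightarrow> 'a poly"
  by unfold_locales (simp_all add: smult_add_right smult_add_left)

definition subalgebra_poly :: "'a::field poly set \<Rightarrow> bool" where
  "subalgebra_poly A \<longleftrightarrow>
     poly_vs.subspace A \<and> 1 \<in> A \<and> (\<forall>p\<in>A. \<forall>q\<in>A. p * q \<in> A)"

definition algs :: "nat \<Rightarrow> 'a::field poly set set" where
  "algs m = {A. subalgebra_poly A \<and> range (\<lambda>q. monom 1 m * q) \<subseteq> A \<and> monom 1 (m - 1) \<notin> A}"

definition Gamma_of :: "nat \<Rightarrow> 'a::field poly set \<Rightarrow> nat set" where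
  "Gamma_of m A =
     {\<gamma>. 1 \<le> \<gamma> \<and> \<gamma> \<le> m - 1 \<and> (\<exists>p\<in>A. (\<forall>j<\<gamma>. coeff p j = 0) \<and> coeff p \<gamma> = 1)}"

definition algs_of :: "nat \<Rightarrow> nat set \<Rightarrow> 'a::field poly set set" where
  "algs_of m \<Gamma> = {A \<in> algs m. Gamma_of m A = \<Gamma>}"

definition ind :: "nat set \<Rightarrow> nat set" where
  "ind \<Gamma> = {\<gamma> \<in> \<Gamma>. \<not> (\<exists>\<alpha>\<in>\<Gamma>. \<exists>\<beta>\<in>\<Gamma>. \<gamma> = \<alpha> + \<beta>)}"

definition gaps_above :: "nat \<Rightarrow> nat set \<Rightarrow> nat \<Rightarrow> nat set" where
  "gaps_above m \<Gamma> \<gamma> = {\<delta>. \<delta> \<notin> \<Gamma> \<and> \<gamma> < \<delta> \<and> \<delta> \<le> m - 1}"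

text \<open>
  The quotient space \<open>K[x]/x\<^sup>mK[x] = \<Oplus>i<m. K x\<^sup>i\<close> is represented by the polynomials of degree
  less than \<open>m\<close>, the class of \<open>p\<close> being represented by \<open>p mod x\<^sup>m\<close>.  The automorphism of the
  quotient induced by \<open>x \<mapsto> c x\<close> acts on these representatives as the automorphism of \<open>K[x]\<close> itself.
\<close>

definition quot_alg :: "nat \<Rightarrow> 'a::field poly set \<Rightarrow> 'a poly set" where
  "quot_alg m A = (\<lambda>p. p mod monom 1 m) ` A"

text \<open>
  The elements of the family \<open>{1, f \<gamma> | \<gamma> \<in> \<Gamma>}\<close> are pairwise distinct because their lowest
  exponents are, so it is enough to speak about the set that they form.
\<close>

definition canonical_basis :: "nat \<Rightarrow> 'a::field poly set \<Rightarrow> (nat \<Rightarrow> 'a poly) \<Rightarrow> bool" where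
  "canonical_basis m A f \<longleftrightarrow>
     (\<forall>\<gamma>\<in>Gamma_of m A. \<exists>c. f \<gamma> = monom 1 \<gamma> + (\<Sum>\<delta>\<in>gaps_above m (Gamma_of m A) \<gamma>. monom (c \<delta>) \<delta>)) \<and>
     poly_vs.independent (insert 1 (f ` Gamma_of m A)) \<and>
     poly_vs.span (insert 1 (f ` Gamma_of m A)) = quot_alg m A"

definition scale_x :: "'a::field \<Rightarrow> 'a poly \<Rightarrow> 'a poly" where
  "scale_x c p = pcompose p [:0, c:]"

definition poly_alg_auto :: "'a::field poly set \<Rightarrow> ('a poly \<Rightarrow> 'a poly) set" where
  "poly_alg_auto A =
     {\<phi> \<in> Bij A. \<phi> 1 = 1 \<and> (\<forall>p\<in>A. \<forall>q\<in>A. \<phi> (p + q) = \<phi> p + \<phi> q \<and> \<phi> (p * q) = \<phi> p * \<phi> q) \<and>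
                 (\<forall>c. \<forall>p\<in>A. \<phi> (smult c p) = smult c (\<phi> p))}"

definition Aut_alg :: "'a::field poly set \<Rightarrow> ('a poly \<Rightarrow> 'a poly) monoid" where
  "Aut_alg A = BijGroup A \<lparr>carrier := poly_alg_auto A\<rparr>"

definition exp_gcd :: "'a::zero poly \<Rightarrow> nat" where
  "exp_gcd u = Gcd {i. 1 \<le> i \<and> coeff u i \<noteq> 0}"

definition coprime_part :: "nat \<Rightarrow> nat \<Rightarrow> nat" where
  "coprime_part p n = (if n = 0 then 0 else n div p ^ multiplicity p n)"

definition exp_gcd_p :: "nat \<Rightarrow> 'a::zero poly \<Rightarrow> nat" where
  "exp_gcd_p p u = coprime_part p (exp_gcd u)"

text \<open>
  For the factors \<open>u\<close> of the canonical basis \<open>f \<gamma> = x\<^sup>\<gamma> u \<gamma>\<close> of an algebra \<open>A\<close>, these are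
  \<open>gcd(A)\<close> and \<open>gcd\<^sub>p(A)\<close> when taken over all of \<open>\<Gamma>\<close>.
\<close>

definition fam_gcd :: "nat set \<Rightarrow> (nat \<Rightarrow> 'a::zero poly) \<Rightarrow> nat" where
  "fam_gcd I u = Gcd ((\<lambda>\<gamma>. exp_gcd (u \<gamma>)) ` I)"

definition fam_gcd_p :: "nat \<Rightarrow> nat set \<Rightarrow> (nat \<Rightarrow> 'a::zero poly) \<Rightarrow> nat" where
  "fam_gcd_p p I u = Gcd ((\<lambda>\<gamma>. exp_gcd_p p (u \<gamma>)) ` I)"

definition primitive_unity_root :: "nat \<Rightarrow> 'a::field \<Rightarrow> bool" where
  "primitive_unity_root n c \<longleftrightarrow> n > 0 \<and> c ^ n = 1 \<and> (\<forall>k. 0 < k \<and> k < n \<longrightarrow> c ^ k \<noteq> 1)"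

lemma group_Aut_alg:
  assumes "subalgebra_poly A"
  shows "group (Aut_alg A)"
proof -
  have cl: "1 \<in> A" "\<And>p q. p \<in> A \<Longrightarrow> q \<in> A \<Longrightarrow> p + q \<in> A"
    "\<And>p q. p \<in> A \<Longrightarrow> q \<in> A \<Longrightarrow> p * q \<in> A" "\<And>c p. p \<in> A \<Longrightarrow> smult c p \<in> A"
    using assms unfolding subalgebra_poly_def
    by (auto intro: poly_vs.subspace_add poly_vs.subspace_scale)
  have "subgroup (poly_alg_auto A) (BijGroup A)"
  proof (rule subgroup.intro)
    show "poly_alg_auto A \<subseteq> carrier (BijGroup A)"
      by (auto simp: poly_alg_auto_def BijGroup_def)
  next
    fix g h assume gh: "g \<in> poly_alg_auto A" "h \<in> poly_alg_auto A"
    then have "g \<in> Bij A" "h \<in> Bij A" "\<And>p. p \<in> A \<Longrightarrow> h p \<in> A"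
      by (auto simp: poly_alg_auto_def dest: Bij_imp_funcset)
    with gh cl show "g \<otimes>\<^bsub>BijGroup A\<^esub> h \<in> poly_alg_auto A"
      by (simp add: BijGroup_def poly_alg_auto_def compose_Bij) (simp add: compose_def)
  next
    show "\<one>\<^bsub>BijGroup A\<^esub> \<in> poly_alg_auto A"
      using cl by (simp add: BijGroup_def poly_alg_auto_def id_Bij)
  next
    fix h assume h: "h \<in> poly_alg_auto A"
    then have B: "h \<in> Bij A" by (simp add: poly_alg_auto_def)
    let ?g = "\<lambda>x\<in>A. inv_into A h x"
    have inj: "inj_on h A" and img: "h ` A = A"
      using B by (auto simp: Bij_def bij_betw_def)
    have gA: "?g p \<in> A" and hg: "h (?g p) = p" if "p \<in> A" for p
      using that img by (auto simp: inv_into_into f_inv_into_f)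
    have eq: "?g p = q" if "p \<in> A" "q \<in> A" "h q = p" for p q
      using that inj by auto
    have "?g \<in> poly_alg_auto A"
      unfolding poly_alg_auto_def
    proof (intro CollectI conjI ballI allI)
      show "?g \<in> Bij A" using B by (rule restrict_inv_into_Bij)
      show "?g 1 = 1" using cl h by (intro eq) (auto simp: poly_alg_auto_def)
    next
      fix p q assume pq: "p \<in> A" "q \<in> A"
      note A = gA[OF pq(1)] gA[OF pq(2)]
      show "?g (p + q) = ?g p + ?g q"
        using cl h A pq hg by (intro eq) (simp_all add: poly_alg_auto_def del: restrict_apply restrict_apply')
      show "?g (p * q) = ?g p * ?g q"
        using cl h A pq hg by (intro eq) (simp_all add: poly_alg_auto_def del: restrict_apply restrict_apply')
    next
      fix c p assume p: "p \<in> A"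
      show "?g (smult c p) = smult c (?g p)"
        using cl h gA[OF p] p hg by (intro eq) (simp_all add: poly_alg_auto_def del: restrict_apply restrict_apply')
    qed
    then show "inv\<^bsub>BijGroup A\<^esub> h \<in> poly_alg_auto A"
      using B by (simp add: inv_BijGroup)
  qed
  then show ?thesis
    unfolding Aut_alg_def by (rule subgroup.subgroup_is_group) (rule group_BijGroup)
qed

end

(*
  An automorphism of A maps x^m and x^(m+1) to elements a and b with a^(m+1) = b^m, so b = a y for
  a polynomial y, and the automorphism is the substitution of y for x.  Surjectivity forces y to
  have degree 1, and since x^m K[x] is the conductor of A in K[x], y has no constant term: the
  automorphism is a scaling x -> c x.  By uniqueness of the canonical basis a scaling preserves A
  iff it fixes all the u_gamma, iff c^gcd(A) = 1.  Indecomposable gamma suffice because the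
  elements that a scaling maps into A form a subalgebra.  Everything else follows by comparing
  groups of roots of unity.
*)

theory Submission
  imports Defs
begin

section \<open>Roots of unity in algebraically closed fields\<close>

text \<open>The obstacle is that x never lies in A, since otherwise x^(m-1) would, so an
  automorphism has no value at x to start from; x is only the quotient of x^(m+1) by x^m. That a
  divides b is forced by a^m dividing b^m, through cancelling linear factors over the algebraically
  closed field. If y had a non-zero constant term, A would contain y^m K[x] beside x^m K[x]; these
  ideals are comaximal, so A would be all of K[x]. In characteristic p the Frobenius map is
  injective, so the equation c^n = 1 sees only the p-coprime part of n. Comparing groups of scalings
  therefore determines a gcd only up to a power of p. Even that much needs primitive roots of unity
  of every order prime to p, and an element that is not an n-th root of unity in order to recognise
  the gcd 0.\<close>

lemma ex_power_eq_1_iff_dvd: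
  fixes c :: "'a::monoid_mult"
  shows "\<exists>d. \<forall>k. c ^ k = 1 \<longleftrightarrow> d dvd k"
proof (cases "\<exists>k>0. c ^ k = 1")
  case True
  define d where "d = (LEAST k. k > 0 \<and> c ^ k = 1)"
  have d: "d > 0" "c ^ d = 1"
    using LeastI_ex[OF True] by (auto simp: d_def)
  have least: "d \<le> k" if "k > 0" "c ^ k = 1" for k
    unfolding d_def using that by (intro Least_le) auto
  have "c ^ k = 1 \<longleftrightarrow> d dvd k" for k
  proof -
    have "c ^ k = c ^ (d * (k div d) + k mod d)" by simp
    also have "\<dots> = c ^ (k mod d)" by (simp only: power_add power_mult d power_one mult_1_left)
    finally have eq: "c ^ k = c ^ (k mod d)" .
    show ?thesis
    proof
      assume "c ^ k = 1"
      then have "c ^ (k mod d) = 1" using eq by simp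
      moreover have "k mod d < d" using d by simp
      ultimately have "k mod d = 0" using least[of "k mod d"] by fastforce
      then show "d dvd k" by (rule mod_0_imp_dvd)
    next
      assume "d dvd k"
      then show "c ^ k = 1" using eq by simp
    qed
  qed
  then show ?thesis by blast
next
  case False
  then have "c ^ k \<noteq> 1" if "k \<noteq> 0" for k using that by blast
  \<comment> \<open>Infinite order is encoded as d = 0, because 0 divides only 0.\<close>
  then have "c ^ k = 1 \<longleftrightarrow> 0 dvd k" for k by (metis dvd_0_left_iff power_0)
  then show ?thesis by blast
qed

text \<open>Each equation says that the order of c divides the exponent, and common divisors are the
  divisors of the \<open>Gcd\<close>. Empty and infinite S are included; an empty S gives the
  exponent 0, which imposes no condition.\<close>

lemma power_Gcd_eq_1_iff:
  fixes c :: "'a::monoid_mult"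
  shows "c ^ Gcd S = 1 \<longleftrightarrow> (\<forall>k\<in>S. c ^ k = 1)"
proof -
  obtain d where "\<And>k. c ^ k = 1 \<longleftrightarrow> d dvd k" using ex_power_eq_1_iff_dvd[of c] by blast
  then show ?thesis by (simp add: dvd_Gcd_iff)
qed

lemma primitive_unity_root_iff:
  "primitive_unity_root n c \<longleftrightarrow> n > 0 \<and> (\<forall>k. c ^ k = 1 \<longleftrightarrow> n dvd k)"
proof
  assume n: "primitive_unity_root n c"
  obtain d where d: "\<And>k. c ^ k = 1 \<longleftrightarrow> d dvd k" using ex_power_eq_1_iff_dvd[of c] by blast
  have "d dvd n" using n d by (auto simp: primitive_unity_root_def)
  moreover have "\<not> (0 < d \<and> d < n)" using n d[of d] by (auto simp: primitive_unity_root_def)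
  ultimately have "d = n"
    using n dvd_imp_le[of d n] by (cases "d = 0") (auto simp: primitive_unity_root_def)
  then show "n > 0 \<and> (\<forall>k. c ^ k = 1 \<longleftrightarrow> n dvd k)"
    using n d by (auto simp: primitive_unity_root_def)
next
  assume "n > 0 \<and> (\<forall>k. c ^ k = 1 \<longleftrightarrow> n dvd k)"
  then show "primitive_unity_root n c" by (auto simp: primitive_unity_root_def dest: dvd_imp_le)
qed

lemma primitive_unity_root_mult:
  assumes a: "primitive_unity_root a x" and b: "primitive_unity_root b y" and "coprime a b"
  shows "primitive_unity_root (a * b) (x * y)"
  unfolding primitive_unity_root_iff
proof (intro conjI allI)
  have x: "a > 0" "\<And>k. x ^ k = 1 \<longleftrightarrow> a dvd k" and y: "b > 0" "\<And>k. y ^ k = 1 \<longleftrightarrow> b dvd k"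
    using a b by (auto simp: primitive_unity_root_iff)
  show "a * b > 0" using x y by simp
  fix k
  show "(x * y) ^ k = 1 \<longleftrightarrow> a * b dvd k"
  proof
    assume 1: "(x * y) ^ k = 1"
    \<comment> \<open>Raising (x y)^k = 1 to the power b removes y, raising it to the power a
      removes x; coprimality then cancels the extra factor.\<close>
    have "y ^ (k * b) = 1" "x ^ (k * a) = 1" by (simp_all only: x y dvd_triv_right)
    moreover have "x ^ (k * j) * y ^ (k * j) = 1" for j
      using 1 by (metis power_mult power_mult_distrib power_one)
    ultimately have "x ^ (k * b) = 1" "y ^ (k * a) = 1" by (metis mult_1_right, metis mult_1_left)
    then have "a dvd k * b" "b dvd k * a" by (simp_all only: x y)
    then have "a dvd k" "b dvd k"
      using \<open>coprime a b\<close> by (simp_all add: coprime_dvd_mult_left_iff coprime_commute)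
    then show "a * b dvd k" using \<open>coprime a b\<close> by (rule divides_mult)
  next
    assume "a * b dvd k"
    then have "a dvd k" "b dvd k" by (auto dest: dvd_mult_left dvd_mult_right)
    then have "x ^ k = 1" "y ^ k = 1" by (simp_all only: x y)
    then show "(x * y) ^ k = 1" by (simp add: power_mult_distrib)
  qed
qed

text \<open>A root of 1 + X + ... + X^(q-1) is a q-th root of unity. It differs from 1 because the
  value of this polynomial at 1 is q, which is non-zero in the field.\<close>

lemma ex_primitive_unity_root_prime:
  assumes q: "prime q" and char: "\<not> CHAR('a::alg_closed_field) dvd q"
  shows "\<exists>c::'a. primitive_unity_root q c"
proof -
  have "q > 1" using q prime_gt_1_nat by blast
  then have "{..q - 1} = {..<q}" by auto
  moreover have "\<exists>c::'a. (\<Sum>k\<le>q - 1. 1 * c ^ k) = 0"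
    using \<open>q > 1\<close> by (intro alg_closed) auto
  ultimately obtain c :: 'a where c: "(\<Sum>k<q. c ^ k) = 0" by (simp only: mult_1_left) blast
  have "c \<noteq> 1"
  proof
    assume "c = 1"
    then have "of_nat q = (0::'a)" using c by simp
    then show False using char by (simp add: of_nat_eq_0_iff_char_dvd)
  qed
  have "c ^ q - 1 = (c - 1) * (\<Sum>k<q. c ^ k)" by (rule power_diff_1_eq)
  then have "c ^ q = 1" using c by simp
  obtain d where d: "\<And>k. c ^ k = 1 \<longleftrightarrow> d dvd k" using ex_power_eq_1_iff_dvd[of c] by blast
  have "d dvd q" "d \<noteq> 1" using \<open>c ^ q = 1\<close> \<open>c \<noteq> 1\<close> d[of q] d[of 1] by auto
  then have "d = q" using q by (auto simp: prime_nat_iff)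
  then show ?thesis using d \<open>q > 1\<close> by (auto simp: primitive_unity_root_iff)
qed

text \<open>Take a q^j-th root of a primitive q-th root of unity: its order divides q^(j+1) but not
  q^j.\<close>

lemma ex_primitive_unity_root_prime_power:
  assumes q: "prime q" and char: "\<not> CHAR('a::alg_closed_field) dvd q"
  shows "\<exists>c::'a. primitive_unity_root (q ^ k) c"
proof (cases k)
  case 0
  then show ?thesis by (intro exI[of _ 1]) (auto simp: primitive_unity_root_def)
next
  case (Suc j)
  obtain w :: 'a where w: "primitive_unity_root q w"
    using ex_primitive_unity_root_prime[OF q char] by blast
  have "q ^ j > 0" using q prime_gt_0_nat by simp
  then obtain c where c: "c ^ (q ^ j) = w" using nth_root_exists by blast
  obtain d where d: "\<And>i. c ^ i = 1 \<longleftrightarrow> d dvd i" using ex_power_eq_1_iff_dvd[of c] by blast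
  have "c ^ (q ^ j * q) = 1" using w by (simp only: power_mult c) (simp add: primitive_unity_root_def)
  then have "d dvd q ^ Suc j" by (simp only: d power_Suc2)
  moreover have "w ^ 1 \<noteq> 1" using w prime_gt_1_nat[OF q] by (auto simp: primitive_unity_root_def)
  then have "\<not> d dvd q ^ j" by (simp add: c flip: d)
  ultimately have "d = q ^ Suc j"
    using divides_primepow_nat[OF q] by (metis le_Suc_eq le_imp_power_dvd)
  then show ?thesis using d prime_gt_0_nat[OF q] Suc by (auto simp: primitive_unity_root_iff)
qed

text \<open>Splitting off the full power of one prime leaves two coprime factors, whose primitive
  roots can be multiplied.\<close>

lemma ex_primitive_unity_root:
  assumes "n > 0" and "\<not> CHAR('a::alg_closed_field) dvd n"
  shows "\<exists>c::'a. primitive_unity_root n c"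
  using assms
proof (induction n rule: less_induct)
  case (less n)
  show ?case
  proof (cases "n = 1")
    case True
    then show ?thesis by (intro exI[of _ 1]) (auto simp: primitive_unity_root_def)
  next
    case False
    then obtain q where q: "prime q" "q dvd n" using prime_factor_nat by blast
    have "\<not> is_unit q" using q by auto
    then obtain r where r: "n = q ^ multiplicity q n * r" "\<not> q dvd r"
      using less.prems multiplicity_decompose'[of n q] by auto
    let ?k = "multiplicity q n"
    have "?k > 0" using q less.prems by (simp add: prime_multiplicity_gt_zero_iff)
    then have "q ^ ?k > 1" using q prime_gt_1_nat one_less_power by blast
    moreover have "r > 0" using r less.prems by (metis gr0I mult_0_right less_irrefl)
    ultimately have "r < n" using r(1)
      by (metis mult_less_mono1 mult.left_neutral)
    moreover have "r dvd n" using r(1) by (metis dvd_triv_right)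
    ultimately obtain y :: 'a where y: "primitive_unity_root r y"
      using less.IH[of r] less.prems \<open>r > 0\<close> dvd_trans by blast
    have "\<not> CHAR('a) dvd q" using less.prems q dvd_trans by blast
    then obtain x :: 'a where x: "primitive_unity_root (q ^ ?k) x"
      using ex_primitive_unity_root_prime_power q by blast
    have "coprime (q ^ ?k) r" using q r by (simp add: prime_imp_coprime)
    then show ?thesis using primitive_unity_root_mult[OF x y] r(1) by metis
  qed
qed

text \<open>The n powers of c are distinct roots of X^n - 1, which has at most n roots.\<close>

lemma
  fixes c :: "'a::field"
  assumes c: "primitive_unity_root n c"
  shows roots_of_unity_eq_powers: "{z. z ^ n = 1} = (\<lambda>k. c ^ k) ` {..<n}"
    and card_roots_of_unity: "card {z::'a. z ^ n = 1} = n"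
proof -
  have n: "n > 0" and ck: "\<And>k. c ^ k = 1 \<longleftrightarrow> n dvd k"
    using c by (auto simp: primitive_unity_root_iff)
  have "c \<noteq> 0" using ck[of n] n by (cases "c = 0") (auto simp: zero_power)
  have "i = j" if "c ^ i = c ^ j" "i \<le> j" "j < n" for i j
  proof -
    have "c ^ i * c ^ (j - i) = c ^ j" using that(2) by (simp flip: power_add)
    then have "c ^ i * c ^ (j - i) = c ^ i * 1" using that(1) by simp
    then have "n dvd j - i" using \<open>c \<noteq> 0\<close> by (simp add: ck)
    then show ?thesis using that by (auto dest: dvd_imp_le)
  qed
  then have inj: "inj_on (\<lambda>k. c ^ k) {..<n}"
    by (intro inj_onI) (metis lessThan_iff nat_le_linear)
  let ?p = "monom 1 n - 1 :: 'a poly"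
  have "coeff ?p n = 1" using n by simp
  then have p: "?p \<noteq> 0" by (metis coeff_0 zero_neq_one)
  have roots: "{z. poly ?p z = 0} = {z. z ^ n = 1}" by (auto simp: poly_monom)
  have "degree ?p \<le> n" by (rule degree_diff_le) (auto simp: degree_monom_le)
  then have le: "card {z::'a. z ^ n = 1} \<le> n" using card_poly_roots_bound[OF p] unfolding roots by linarith
  have fin: "finite {z::'a. z ^ n = 1}" using poly_roots_finite[OF p] by (simp only: roots)
  have "(c ^ k) ^ n = 1" for k by (simp add: ck flip: power_mult)
  then have sub: "(\<lambda>k. c ^ k) ` {..<n} \<subseteq> {z. z ^ n = 1}" by auto
  show eq: "{z. z ^ n = 1} = (\<lambda>k. c ^ k) ` {..<n}"
    using card_seteq[OF fin sub] le by (simp add: card_image[OF inj])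
  show "card {z::'a. z ^ n = 1} = n" unfolding eq by (simp add: card_image[OF inj])
qed

text \<open>A root of \<open>X\<^sup>n\<^sup>+\<^sup>1 - X + 1\<close> is not fixed by \<open>z \<mapsto> z\<^sup>n\<^sup>+\<^sup>1\<close>.\<close>

lemma ex_power_neq_1:
  assumes "n > 0"
  shows "\<exists>c::'a::alg_closed_field. c \<noteq> 0 \<and> c ^ n \<noteq> 1"
proof -
  let ?p = "monom 1 (Suc n) - monom 1 1 + 1 :: 'a poly"
  have "coeff ?p (Suc n) \<noteq> 0" using assms by simp
  then have "degree ?p > 0" using le_degree[of ?p "Suc n"] by linarith
  then obtain c where c: "poly ?p c = 0" using alg_closed_imp_poly_has_root by blast
  then have "c * c ^ n - c + 1 = 0" by (simp add: poly_monom)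
  then show ?thesis by (intro exI[of _ c]) auto
qed

section \<open>The part of a number that is coprime to the characteristic\<close>

lemma coprime_part_0 [simp]: "coprime_part p 0 = 0"
  by (simp add: coprime_part_def)

lemma coprime_part_eq_0_iff [simp]: "coprime_part p n = 0 \<longleftrightarrow> n = 0"
  by (auto simp: coprime_part_def dvd_div_eq_0_iff multiplicity_dvd)

text \<open>Since \<open>multiplicity 0 n = 0\<close>, the case \<open>p = 0\<close> covers fields of characteristic zero.\<close>

lemma coprime_part_0_left [simp]: "coprime_part 0 n = n"
  by (simp add: coprime_part_def)

lemma coprime_part_decompose: "n = coprime_part p n * p ^ multiplicity p n"
  by (simp add: coprime_part_def multiplicity_dvd)

lemma not_dvd_coprime_part:
  assumes "n > 0" "p \<noteq> 1"
  shows "\<not> p dvd coprime_part p n"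
  using assms multiplicity_decompose[of n p] by (simp add: coprime_part_def)

text \<open>A natural number is determined by its divisors, so this reduces identities between
  coprime parts to logic. The exception n = 0 reflects the convention that its coprime part is 0,
  which p divides.\<close>

lemma dvd_coprime_part_iff:
  assumes p: "p = 0 \<or> prime p"
  shows "d dvd coprime_part p n \<longleftrightarrow> d dvd n \<and> (n = 0 \<or> \<not> p dvd d)"
proof (cases "n = 0 \<or> p = 0")
  case True
  then show ?thesis by auto
next
  case False
  then have "prime p" "n > 0" using p by auto
  then have nd: "\<not> p dvd coprime_part p n" by (intro not_dvd_coprime_part) auto
  show ?thesis
  proof
    assume d: "d dvd coprime_part p n"
    then have "d dvd n" by (subst coprime_part_decompose[of n p]) (rule dvd_mult2)
    then show "d dvd n \<and> (n = 0 \<or> \<not> p dvd d)" using d nd dvd_trans by blast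
  next
    assume "d dvd n \<and> (n = 0 \<or> \<not> p dvd d)"
    then have "d dvd coprime_part p n * p ^ multiplicity p n" "\<not> p dvd d"
      using \<open>n > 0\<close> by (auto simp flip: coprime_part_decompose)
    moreover have "coprime p d" using \<open>prime p\<close> calculation(2) by (rule prime_imp_coprime)
    then have "coprime d (p ^ multiplicity p n)" by (simp add: coprime_commute)
    ultimately show "d dvd coprime_part p n" by (simp add: coprime_dvd_mult_left_iff)
  qed
qed

lemma Gcd_coprime_part:
  assumes p: "p = 0 \<or> prime p"
  shows "Gcd (coprime_part p ` N) = coprime_part p (Gcd N)"
proof -
  have "d dvd Gcd (coprime_part p ` N) \<longleftrightarrow> d dvd coprime_part p (Gcd N)" for d
    using p by (auto simp: dvd_Gcd_iff dvd_coprime_part_iff Gcd_0_iff)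
  then show ?thesis by (meson dvd_antisym dvd_refl)
qed

lemma fam_gcd_p_eq:
  assumes "p = 0 \<or> prime p"
  shows "fam_gcd_p p I u = coprime_part p (fam_gcd I u)"
  using Gcd_coprime_part[OF assms, of "(\<lambda>\<gamma>. exp_gcd (u \<gamma>)) ` I"]
  by (simp add: fam_gcd_p_def fam_gcd_def exp_gcd_p_def image_image)

lemma CHAR_0_or_prime: "CHAR('a::idom) = 0 \<or> prime CHAR('a)"
  using prime_CHAR_semidom[where ?'a='a] by auto

text \<open>With k the coprime part of n and q the remaining power of the characteristic, c^n - 1 =
  (c^k - 1)^q by Frobenius.\<close>

lemma power_coprime_part_eq_1_iff:
  fixes c :: "'a::idom"
  shows "c ^ coprime_part CHAR('a) n = 1 \<longleftrightarrow> c ^ n = 1"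
proof (cases "prime CHAR('a)")
  case False
  then have "CHAR('a) = 0" using CHAR_0_or_prime by blast
  then show ?thesis by simp
next
  case True
  let ?k = "coprime_part CHAR('a) n" and ?q = "CHAR('a) ^ multiplicity CHAR('a) n"
  have "c ^ n = (c ^ ?k - 1 + 1) ^ ?q"
    by (subst coprime_part_decompose[of n "CHAR('a)"]) (simp add: power_mult)
  also have "\<dots> = (c ^ ?k - 1) ^ ?q + 1"
    using freshmans_dream'[OF True refl, of "c ^ ?k - 1" 1] by simp
  finally show ?thesis using True by (auto dest: prime_gt_0_nat)
qed

text \<open>A primitive root of unity whose order is the coprime part of h tests whether that part
  divides the one of g; symmetry gives equality.\<close>

lemma coprime_part_eqI:
  fixes g h :: nat
  assumes eq: "\<And>c::'a::alg_closed_field. c \<noteq> 0 \<Longrightarrow> c ^ g = 1 \<longleftrightarrow> c ^ h = 1"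
  shows "coprime_part CHAR('a) g = coprime_part CHAR('a) h"
proof -
  have CHAR: "CHAR('a) \<noteq> 1" using CHAR_0_or_prime[where ?'a='a] by auto
  have dvd: "coprime_part CHAR('a) h dvd coprime_part CHAR('a) g"
    if gh: "\<And>c::'a. c \<noteq> 0 \<Longrightarrow> c ^ h = 1 \<Longrightarrow> c ^ g = 1" for g h
  proof (cases "h = 0")
    case True
    \<comment> \<open>For h = 0 no primitive root is available. Every non-zero c would be a g-th
      root of unity, which is impossible for g > 0.\<close>
    then have "g = 0" using ex_power_neq_1[of g, where ?'a='a] gh by auto
    then show ?thesis by simp
  next
    case False
    have pos: "coprime_part CHAR('a) h > 0" using False coprime_part_eq_0_iff gr0I by metis
    moreover have "\<not> CHAR('a) dvd coprime_part CHAR('a) h"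
      using False by (intro not_dvd_coprime_part CHAR) simp
    ultimately obtain c :: 'a where c: "primitive_unity_root (coprime_part CHAR('a) h) c"
      using ex_primitive_unity_root by blast
    then have 1: "c ^ coprime_part CHAR('a) h = 1" by (simp add: primitive_unity_root_def)
    then have "c \<noteq> 0" using pos by (auto simp: zero_power)
    then have "c ^ coprime_part CHAR('a) g = 1"
      using gh 1 by (simp only: power_coprime_part_eq_1_iff)
    then show ?thesis using c by (simp add: primitive_unity_root_iff)
  qed
  show ?thesis using eq by (intro dvd_antisym dvd) auto
qed

section \<open>Automorphisms are scalings\<close>

text \<open>A root of a is also a root of b, so the same linear factor can be cancelled from both;
  the degree of a drops.\<close>

lemma dvd_if_power_dvd_power_poly:
  fixes a b :: "'a::alg_closed_field poly"
  assumes "m > 0" "a ^ m dvd b ^ m"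
  shows "a dvd b"
  using assms(2)
proof (induction "degree a" arbitrary: a b rule: less_induct)
  case less
  show ?case
  proof (cases "degree a = 0")
    case True
    then obtain k where a: "a = [:k:]" by (rule degree_eq_zeroE)
    show ?thesis
    proof (cases "k = 0")
      case True
      then have "b ^ m = 0" using less.prems \<open>m > 0\<close> by (simp add: a zero_power)
      then show ?thesis by simp
    next
      case False
      then show ?thesis by (simp add: a const_poly_dvd_iff dvd_field_iff)
    qed
  next
    case False
    then obtain x where "poly a x = 0" using alg_closed_imp_poly_has_root by blast
    then have x: "[:-x, 1:] dvd a" by (simp add: poly_eq_0_iff_dvd)
    have "[:-x, 1:] ^ m dvd b ^ m" using x less.prems dvd_power_same dvd_trans by blast
    then have "poly (b ^ m) x = 0"
      using \<open>m > 0\<close> by (metis dvd_trans dvd_power poly_eq_0_iff_dvd)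
    then have "[:-x, 1:] dvd b" by (simp add: poly_eq_0_iff_dvd)
    with x obtain a' b' where ab: "a = [:-x, 1:] * a'" "b = [:-x, 1:] * b'" by (auto elim!: dvdE)
    have pow: "a' ^ m dvd b' ^ m" using less.prems unfolding ab by (simp only: power_mult_distrib) simp
    have "a' \<noteq> 0" using False ab by auto
    then have "degree a = 1 + degree a'" unfolding ab(1) by (subst degree_mult_eq) auto
    then have "a' dvd b'" using less.hyps[OF _ pow] by linarith
    then show ?thesis unfolding ab by (rule mult_dvd_mono[OF dvd_refl])
  qed
qed

section \<open>Scalings of the variable and the polynomials that they fix\<close>

lemma pcompose_monom: "pcompose (monom c k) p = smult c (p ^ k)"
  for p :: "'a::comm_semiring_1 poly"
  by (induction k) (simp_all add: monom_0 monom_Suc pcompose_pCons)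

lemma coeff_scale_x [simp]: "coeff (scale_x c p) i = c ^ i * coeff p i"
  by (simp add: scale_x_def coeff_pcompose_linear)

lemma scale_x_add: "scale_x c (p + q) = scale_x c p + scale_x c q"
  by (simp add: scale_x_def pcompose_add)

lemma scale_x_mult: "scale_x c (p * q) = scale_x c p * scale_x c q"
  by (simp add: scale_x_def pcompose_mult)

lemma scale_x_smult: "scale_x c (smult k p) = smult k (scale_x c p)"
  by (simp add: scale_x_def pcompose_smult)

lemma scale_x_poly_1 [simp]: "scale_x c 1 = 1"
  by (simp add: scale_x_def pcompose_1)

lemma scale_x_poly_0 [simp]: "scale_x c 0 = 0"
  by (simp add: scale_x_def)

lemma scale_x_monom: "scale_x c (monom a k) = monom (a * c ^ k) k"
  by (rule poly_eqI) (auto simp: mult.commute)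

lemma scale_x_scale_x: "scale_x c (scale_x d p) = scale_x (c * d) p"
  by (rule poly_eqI) (simp add: power_mult_distrib)

lemma scale_x_1 [simp]: "scale_x 1 p = p"
  by (rule poly_eqI) simp

lemma scale_x_eq_self_iff: "scale_x c u = u \<longleftrightarrow> c ^ exp_gcd u = 1"
proof -
  have "scale_x c u = u \<longleftrightarrow> (\<forall>i. coeff u i \<noteq> 0 \<longrightarrow> c ^ i = 1)"
    by (auto simp: poly_eq_iff)
  also have "\<dots> \<longleftrightarrow> (\<forall>i\<in>{i. 1 \<le> i \<and> coeff u i \<noteq> 0}. c ^ i = 1)"
    by (auto simp: Suc_le_eq) (metis gr0I power_0)
  finally show ?thesis by (simp only: exp_gcd_def power_Gcd_eq_1_iff)
qed

lemma scale_x_fixes_family_iff: "(\<forall>\<gamma>\<in>I. scale_x c (u \<gamma>) = u \<gamma>) \<longleftrightarrow> c ^ fam_gcd I u = 1"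
  by (simp add: fam_gcd_def power_Gcd_eq_1_iff scale_x_eq_self_iff)

lemma scale_x_monom_mult_eq_iff:
  assumes "c \<noteq> 0"
  shows "scale_x c (monom 1 \<gamma> * u) = smult (c ^ \<gamma>) (monom 1 \<gamma> * u) \<longleftrightarrow> scale_x c u = u"
proof -
  have "scale_x c (monom 1 \<gamma> * u) = smult (c ^ \<gamma>) (monom 1 \<gamma> * scale_x c u)"
    by (simp add: scale_x_mult scale_x_monom smult_monom flip: mult_smult_left)
  then show ?thesis using assms by simp
qed

lemma exp_gcd_eq_0_iff:
  assumes "coeff u 0 = 1"
  shows "exp_gcd u = 0 \<longleftrightarrow> u = 1"
proof -
  have "exp_gcd u = 0 \<longleftrightarrow> (\<forall>i>0. coeff u i = 0)" 
    by (auto simp: exp_gcd_def Gcd_0_iff subset_iff Suc_le_eq) (metis less_irrefl)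
  also have "\<dots> \<longleftrightarrow> u = 1" 
    using assms by (auto simp: poly_eq_iff one_pCons coeff_pCons gr0_conv_Suc split: nat.splits)
  finally show ?thesis .
qed

section \<open>Automorphisms of an algebra with conductor x^m K[x]\<close>

locale monomial_conductor =
  fixes m :: nat and A :: "'a::alg_closed_field poly set"
  assumes m: "m \<ge> 2" and A: "A \<in> algs m"
begin

lemma subalgebra: "subalgebra_poly A"
  using A by (simp add: algs_def)

lemma
  shows one_mem: "1 \<in> A"
    and add_mem: "\<And>p q. p \<in> A \<Longrightarrow> q \<in> A \<Longrightarrow> p + q \<in> A"
    and diff_mem: "\<And>p q. p \<in> A \<Longrightarrow> q \<in> A \<Longrightarrow> p - q \<in> A"
    and mult_mem: "\<And>p q. p \<in> A \<Longrightarrow> q \<in> A \<Longrightarrow> p * q \<in> A"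
    and smult_mem: "\<And>c p. p \<in> A \<Longrightarrow> smult c p \<in> A"
  using subalgebra unfolding subalgebra_poly_def
  by (auto intro: poly_vs.subspace_add poly_vs.subspace_diff poly_vs.subspace_scale)

lemma conductor_mem: "monom 1 m * q \<in> A"
  using A by (auto simp: algs_def)

lemma mem_if_low_coeffs_0:
  assumes "\<And>i. i < m \<Longrightarrow> coeff p i = 0"
  shows "p \<in> A"
proof -
  have "monom 1 m dvd p" using assms by (simp add: monom_1_dvd_iff')
  then show ?thesis using conductor_mem by (auto elim!: dvdE)
qed

lemma monom_mem: "k \<ge> m \<Longrightarrow> monom 1 k \<in> A"
  by (rule mem_if_low_coeffs_0) auto

lemma group_Aut: "group (Aut_alg A)"
  using subalgebra by (rule group_Aut_alg)

lemma not_UNIV: "A \<noteq> UNIV"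
  using A by (auto simp: algs_def)

text \<open>Justifies identifying a scaling with its restriction: for non-zero c, the images of x^m
  and x^(m+1) give c as the quotient of c^(m+1) by c^m.\<close>

lemma inj_restrict_scale_x: "inj (\<lambda>c. restrict (scale_x c) A)"
proof (rule injI)
  fix c d assume eq: "restrict (scale_x c) A = restrict (scale_x d) A"
  have k: "c ^ k = d ^ k" if "k \<ge> m" for k
  proof -
    have "scale_x c (monom 1 k) = scale_x d (monom 1 k)"
      using fun_cong[OF eq, of "monom 1 k"] monom_mem[OF that] by simp
    then show ?thesis by (simp add: scale_x_monom)
  qed
  have "c * c ^ m = d * d ^ m" using k[of "Suc m"] by simp
  moreover have "c ^ m = d ^ m" by (rule k) simp
  ultimately show "c = d" using m by (cases "d = 0") (auto simp: power_0_left)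
qed

text \<open>
  Since \<open>\<phi>(x\<^sup>m)\<^sup>m\<^sup>+\<^sup>1 = \<phi>(x\<^sup>m\<^sup>+\<^sup>1)\<^sup>m\<close>, the quotient \<open>y = \<phi>(x\<^sup>m\<^sup>+\<^sup>1) / \<phi>(x\<^sup>m)\<close> is a polynomial, and \<open>\<phi>\<close>
  extends to the substitution of \<open>y\<close> for \<open>x\<close>.
\<close>

lemma automorphism_eq_pcompose:
  assumes \<phi>: "\<phi> \<in> poly_alg_auto A"
  shows "\<exists>y. \<forall>p\<in>A. \<phi> p = pcompose p y"
proof -
  have add: "\<phi> (p + q) = \<phi> p + \<phi> q" and mult: "\<phi> (p * q) = \<phi> p * \<phi> q"
    if "p \<in> A" "q \<in> A" for p q
    using \<phi> that by (auto simp: poly_alg_auto_def)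
  have smult: "\<phi> (smult c p) = smult c (\<phi> p)" if "p \<in> A" for c p
    using \<phi> that by (auto simp: poly_alg_auto_def)
  have one: "\<phi> 1 = 1" and inj: "inj_on \<phi> A"
    using \<phi> by (auto simp: poly_alg_auto_def Bij_def bij_betw_def)
  have zero: "\<phi> 0 = 0" using smult[OF one_mem, of 0] by simp
  have power_mem: "p ^ k \<in> A" if "p \<in> A" for p k
    by (induction k) (auto intro: one_mem mult_mem that)
  have power: "\<phi> (p ^ k) = \<phi> p ^ k" if "p \<in> A" for p k
    by (induction k) (simp_all add: one mult power_mem that)
  define a b where "a = \<phi> (monom 1 m)" and "b = \<phi> (monom 1 (Suc m))"
  have "a ^ Suc m = \<phi> (monom 1 m ^ Suc m)" unfolding a_def by (rule power[symmetric]) (simp add: monom_mem)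
  also have "monom 1 m ^ Suc m = (monom 1 (Suc m) ^ m :: 'a poly)"
    by (simp only: monom_power) (simp add: algebra_simps)
  also have "\<phi> \<dots> = b ^ m" unfolding b_def by (rule power) (simp add: monom_mem)
  finally have ab: "a ^ Suc m = b ^ m" .
  have "a ^ m dvd b ^ m" unfolding ab[symmetric] by simp
  then have "a dvd b" using m dvd_if_power_dvd_power_poly[of m a b] by simp
  then obtain y where y: "b = a * y" by (rule dvdE)
  have "a \<noteq> 0"
  proof
    assume "a = 0"
    then have "\<phi> (monom 1 m) = \<phi> 0" by (simp add: a_def zero)
    then have "monom 1 m = (0::'a poly)"
      by (rule inj_onD[OF inj]) (use conductor_mem[of 0] monom_mem[of m] in auto)
    then show False by simp
  qed
  have "a ^ m * a = a ^ m * y ^ m" using ab by (simp add: y power_mult_distrib mult.commute)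
  then have a: "a = y ^ m" using \<open>a \<noteq> 0\<close> by simp
  have "\<phi> (monom 1 (m + k)) = y ^ (m + k)" for k
  proof -
    \<comment> \<open>Multiplying x^(m+k) by x^(mk) gives x^m x^((m+1)k), so the values a and b
      already determine the image of x^(m+k).\<close>
    have "monom 1 (m + k) * monom 1 m ^ k = monom 1 m * (monom 1 (Suc m) ^ k :: 'a poly)"
      by (simp only: monom_power mult_monom) (simp add: algebra_simps)
    then have "\<phi> (monom 1 (m + k)) * a ^ k = a * b ^ k"
      unfolding a_def b_def
      by (metis le_add1 le_refl le_SucI monom_mem mult power power_mem)
    also have "a * b ^ k = y ^ (m + k) * a ^ k"
      by (simp add: y power_mult_distrib power_add flip: a)
    finally show ?thesis using \<open>a \<noteq> 0\<close> by simp
  qed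
  then have mon: "\<phi> (monom c k) = pcompose (monom c k) y" if "k \<ge> m" for c k
    using that smult[OF monom_mem[OF that], of c] pcompose_smult[of c "monom 1 k" y]
    by (auto simp: smult_monom le_iff_add pcompose_monom)
  have high: "\<phi> (monom 1 k * q) = pcompose (monom 1 k * q) y" if "k \<ge> m" for k q
    using that
  proof (induction q arbitrary: k)
    case (pCons c q)
    have "monom 1 k * pCons c q = monom c k + monom 1 (Suc k) * q"
      by (simp add: mult_pCons_right smult_monom monom_Suc)
    moreover have "monom 1 (Suc k) * q \<in> A" "monom c k \<in> A"
      using pCons.prems by (auto intro!: mem_if_low_coeffs_0 simp: coeff_monom_mult)
    ultimately show ?case using pCons by (simp add: add pcompose_add mon)
  qed (simp add: zero)
  have "\<phi> p = pcompose p y" if "p \<in> A" for p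
  proof -
    \<comment> \<open>An element of A of low order is moved into the ideal x^m K[x], where the
      formula is known; the factor a is cancelled afterwards.\<close>
    have "a * \<phi> p = pcompose (monom 1 m * p) y"
      using that high[of m p] by (simp add: a_def mult monom_mem)
    also have "\<dots> = a * pcompose p y"
      using high[of m 1] by (simp add: pcompose_mult a_def)
    finally show ?thesis using \<open>a \<noteq> 0\<close> by simp
  qed
  then show ?thesis by blast
qed

lemma automorphism_eq_scale_x:
  assumes \<phi>: "\<phi> \<in> poly_alg_auto A"
  shows "\<exists>c. c \<noteq> 0 \<and> \<phi> = restrict (scale_x c) A"
proof -
  obtain y where y: "\<And>p. p \<in> A \<Longrightarrow> \<phi> p = pcompose p y"
    using automorphism_eq_pcompose[OF \<phi>] by blast
  have img: "\<phi> ` A = A" and ext: "\<phi> \<in> extensional A"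
    using \<phi> by (auto simp: poly_alg_auto_def Bij_def bij_betw_def)
  \<comment> \<open>Degrees of images are multiples of the degree of y, while by surjectivity the
    consecutive degrees m and m + 1 occur.\<close>
  have "degree y dvd k" if "k \<ge> m" for k
  proof -
    have "monom 1 k \<in> \<phi> ` A" using monom_mem[OF that] img by simp
    then obtain p where "monom 1 k = pcompose p y" using y by auto
    then have "k = degree p * degree y" by (metis degree_monom_eq degree_pcompose zero_neq_one)
    then show ?thesis by simp
  qed
  from this[of m] this[of "Suc m"] have "degree y dvd m + 1 - m" by (intro dvd_diff_nat) auto
  then have "degree y = 1" by simp
  then obtain b c where bc: "y = [:b, c:]" "c \<noteq> 0" by (rule degree1_coeffs)
  have "b = 0"
  proof (rule ccontr)
    assume "b \<noteq> 0"
    have ym: "y ^ m * q \<in> A" for q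
    proof -
      \<comment> \<open>The linear polynomial inverse to y under composition: it yields a preimage
        in x^m K[x] for every multiple of y^m.\<close>
      have "pcompose [:-b/c, 1/c:] y = [:0, 1:]" using bc by (simp add: pcompose_pCons)
      then have "pcompose (monom 1 m * pcompose q [:-b/c, 1/c:]) y = y ^ m * q"
        by (simp add: pcompose_mult pcompose_monom flip: pcompose_assoc)
      then have "\<phi> (monom 1 m * pcompose q [:-b/c, 1/c:]) = y ^ m * q" by (simp add: y conductor_mem)
      then show ?thesis using img conductor_mem by (metis imageI)
    qed
    \<comment> \<open>\<open>x\<^sup>m\<close> and \<open>y\<^sup>m\<close> are comaximal because \<open>y - c x\<close> is the constant \<open>b\<close>.\<close>
    have "y ^ i * monom 1 j * q \<in> A" if "i \<le> m" "j \<le> m" for i j q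
      using that
    proof (induction i arbitrary: j q rule: inc_induct)
      case base
      then show ?case using ym by (simp add: mult.assoc)
    next
      case (step i)
      note step_i = step.IH
      show ?case using step.prems
      proof (induction j arbitrary: q rule: inc_induct)
        case base
        have "y ^ i * monom 1 m * q = monom 1 m * (y ^ i * q)" by (simp add: mult_ac)
        then show ?case by (simp only: conductor_mem)
      next
        case (step j)
        let ?r = "y ^ i * monom 1 j * q"
        have "smult b ?r = (y - smult c (monom 1 1)) * ?r" by (simp add: bc monom_Suc monom_0)
        also have "\<dots> = y ^ Suc i * monom 1 j * q - smult c (y ^ i * (monom 1 1 * monom 1 j) * q)"
          by (simp add: algebra_simps)
        also have "monom 1 1 * monom 1 j = (monom 1 (Suc j) :: 'a poly)" by (simp add: mult_monom)
        also have "y ^ Suc i * monom 1 j * q - smult c (y ^ i * monom 1 (Suc j) * q) \<in> A"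
          using step.hyps by (intro diff_mem smult_mem step_i step.IH) simp
        finally have "smult (inverse b) (smult b ?r) \<in> A" by (rule smult_mem)
        then show ?case using \<open>b \<noteq> 0\<close> by simp
      qed
    qed
    from this[of 0 0] have "A = UNIV" by auto
    then show False using not_UNIV by simp
  qed
  then have "\<phi> p = scale_x c p" if "p \<in> A" for p using y[OF that] bc by (simp add: scale_x_def)
  then have "\<phi> = restrict (scale_x c) A" using ext by (auto simp: fun_eq_iff extensional_def)
  then show ?thesis using bc by blast
qed

end

lemma restrict_scale_x_poly_alg_auto:
  assumes "c \<noteq> 0" and "\<And>p. p \<in> A \<Longrightarrow> scale_x c p \<in> A"
    and "\<And>p. p \<in> A \<Longrightarrow> scale_x (inverse c) p \<in> A" and "subalgebra_poly A"
  shows "restrict (scale_x c) A \<in> poly_alg_auto A"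
proof -
  have cl: "1 \<in> A" "\<And>p q. p \<in> A \<Longrightarrow> q \<in> A \<Longrightarrow> p + q \<in> A"
    "\<And>p q. p \<in> A \<Longrightarrow> q \<in> A \<Longrightarrow> p * q \<in> A" "\<And>c p. p \<in> A \<Longrightarrow> smult c p \<in> A"
    using assms(4) unfolding subalgebra_poly_def
    by (auto intro: poly_vs.subspace_add poly_vs.subspace_scale)
  have "bij_betw (scale_x c) A A"
    using assms by (intro bij_betw_byWitness[where f' = "scale_x (inverse c)"]) (auto simp: scale_x_scale_x)
  then have "restrict (scale_x c) A \<in> Bij A" by (simp add: Bij_def)
  then show ?thesis
    using cl by (simp add: poly_alg_auto_def scale_x_add scale_x_mult scale_x_smult)
qed

lemma one_Aut_alg: "\<one>\<^bsub>Aut_alg A\<^esub> = restrict (scale_x 1) A"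
  by (auto simp: Aut_alg_def BijGroup_def intro!: restrict_ext)

lemma mult_Aut_alg:
  assumes "restrict (scale_x c) A \<in> carrier (Aut_alg A)" "restrict (scale_x d) A \<in> carrier (Aut_alg A)"
  shows "restrict (scale_x c) A \<otimes>\<^bsub>Aut_alg A\<^esub> restrict (scale_x d) A = restrict (scale_x (c * d)) A"
proof -
  have B: "restrict (scale_x c) A \<in> Bij A" "restrict (scale_x d) A \<in> Bij A"
    using assms by (simp_all add: Aut_alg_def poly_alg_auto_def)
  have "scale_x d p \<in> A" if "p \<in> A" for p
    using funcset_mem[OF Bij_imp_funcset[OF B(2)] that] that by simp
  then show ?thesis
    using B by (auto simp: Aut_alg_def BijGroup_def compose_def scale_x_scale_x intro!: restrict_ext)
qed

section \<open>Scalings that preserve A, in terms of its canonical basis\<close>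

locale canonical_basis_alg = monomial_conductor m A
  for m and A :: "'a::alg_closed_field poly set" +
  fixes f u :: "nat \<Rightarrow> 'a poly"
  assumes f: "canonical_basis m A f"
    and fu: "\<And>\<gamma>. \<gamma> \<in> Gamma_of m A \<Longrightarrow> f \<gamma> = monom 1 \<gamma> * u \<gamma>"
begin

abbreviation "\<Gamma> \<equiv> Gamma_of m A"

lemma GammaI:
  assumes "p \<in> A" "1 \<le> \<gamma>" "\<gamma> < m" "\<And>j. j < \<gamma> \<Longrightarrow> coeff p j = 0" "coeff p \<gamma> \<noteq> 0"
  shows "\<gamma> \<in> \<Gamma>"
proof -
  have "smult (inverse (coeff p \<gamma>)) p \<in> A" using assms(1) by (rule smult_mem)
  then show ?thesis
    using assms unfolding Gamma_of_def by (auto intro!: bexI[of _ "smult (inverse (coeff p \<gamma>)) p"])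
qed

text \<open>Reduction modulo x^m changes an element of A by a multiple of x^m, which is again in
  A.\<close>

lemma basis_mem:
  assumes "\<gamma> \<in> \<Gamma>"
  shows "f \<gamma> \<in> A"
proof -
  have "f \<gamma> \<in> quot_alg m A"
    using f assms poly_vs.span_base[of "f \<gamma>" "insert 1 (f ` \<Gamma>)"]
    by (auto simp: canonical_basis_def)
  then obtain p where p: "p \<in> A" "f \<gamma> = p mod monom 1 m" by (auto simp: quot_alg_def)
  then have "f \<gamma> = p - monom 1 m * (p div monom 1 m)" by (simp add: minus_mult_div_eq_mod)
  then show ?thesis using p conductor_mem diff_mem by simp
qed

lemma
  assumes "\<gamma> \<in> \<Gamma>"
  shows coeff_basis_self: "coeff (f \<gamma>) \<gamma> = 1"
    and coeff_basis_eq_0: "\<And>j. j \<noteq> \<gamma> \<Longrightarrow> j \<notin> gaps_above m \<Gamma> \<gamma> \<Longrightarrow> coeff (f \<gamma>) j = 0"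
proof -
  obtain c where c: "f \<gamma> = monom 1 \<gamma> + (\<Sum>\<delta>\<in>gaps_above m \<Gamma> \<gamma>. monom (c \<delta>) \<delta>)"
    using f assms by (auto simp: canonical_basis_def)
  have "finite (gaps_above m \<Gamma> \<gamma>)" by (rule finite_subset[of _ "{..m - 1}"]) (auto simp: gaps_above_def)
  then have "coeff (f \<gamma>) j = (if j = \<gamma> then 1 else 0) + (if j \<in> gaps_above m \<Gamma> \<gamma> then c j else 0)" for j
    by (simp add: c coeff_sum eq_commute)
  then show "coeff (f \<gamma>) \<gamma> = 1" "\<And>j. j \<noteq> \<gamma> \<Longrightarrow> j \<notin> gaps_above m \<Gamma> \<gamma> \<Longrightarrow> coeff (f \<gamma>) j = 0"
    by (auto simp: gaps_above_def)
qed

lemma scale_basis_iff: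
  assumes "\<gamma> \<in> \<Gamma>" "c \<noteq> 0"
  shows "scale_x c (f \<gamma>) = smult (c ^ \<gamma>) (f \<gamma>) \<longleftrightarrow> scale_x c (u \<gamma>) = u \<gamma>"
  using scale_x_monom_mult_eq_iff[OF assms(2)] fu[OF assms(1)] by simp

lemma basis_eq_monom_iff:
  assumes "\<gamma> \<in> \<Gamma>"
  shows "f \<gamma> = monom 1 \<gamma> \<longleftrightarrow> exp_gcd (u \<gamma>) = 0"
proof -
  have "coeff (u \<gamma>) 0 = 1"
    using coeff_basis_self[OF assms] fu[OF assms] by (simp add: coeff_monom_mult)
  then have "exp_gcd (u \<gamma>) = 0 \<longleftrightarrow> u \<gamma> = 1" by (rule exp_gcd_eq_0_iff)
  also have "u \<gamma> = 1 \<longleftrightarrow> monom 1 \<gamma> * u \<gamma> = monom 1 \<gamma> * 1" by (subst mult_left_cancel) auto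
  finally show ?thesis using fu[OF assms] by auto
qed

text \<open>The difference of the two sides lies in A, and its coefficient at \<gamma> cancels, so
  all its exponents are gaps. If it were non-zero, its lowest exponent would belong to
  \<Gamma>.\<close>

lemma scale_basis_if_stable:
  assumes "c \<noteq> 0" and stable: "\<And>p. p \<in> A \<Longrightarrow> scale_x c p \<in> A" and \<gamma>: "\<gamma> \<in> \<Gamma>"
  shows "scale_x c (f \<gamma>) = smult (c ^ \<gamma>) (f \<gamma>)"
proof (rule ccontr)
  assume neq: "scale_x c (f \<gamma>) \<noteq> smult (c ^ \<gamma>) (f \<gamma>)"
  define h where "h = scale_x c (f \<gamma>) - smult (c ^ \<gamma>) (f \<gamma>)"
  have "h \<in> A" unfolding h_def using \<gamma> by (intro diff_mem stable smult_mem basis_mem)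
  have "\<exists>j. coeff h j \<noteq> 0" using neq by (metis coeff_0 eq_iff_diff_eq_0 h_def poly_eqI)
  define j where "j = (LEAST j. coeff h j \<noteq> 0)"
  have j: "coeff h j \<noteq> 0" unfolding j_def by (rule LeastI_ex) fact
  have below: "coeff h i = 0" if "i < j" for i using that not_less_Least unfolding j_def by blast
  have "coeff h i = (c ^ i - c ^ \<gamma>) * coeff (f \<gamma>) i" for i by (simp add: h_def algebra_simps)
  then have "j \<in> gaps_above m \<Gamma> \<gamma>" using j coeff_basis_eq_0[OF \<gamma>, of j] by auto
  then have "j \<notin> \<Gamma>" "1 \<le> j" "j < m" using m by (auto simp: gaps_above_def)
  moreover have "j \<in> \<Gamma>" using \<open>h \<in> A\<close> calculation(2,3) below j by (rule GammaI)
  ultimately show False by simp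
qed

text \<open>
  The elements of \<open>A\<close> that are mapped into \<open>A\<close> form a subalgebra, and a subalgebra that contains
  \<open>x\<^sup>mK[x]\<close> and the \<open>f\<^sub>\<nu>\<close> with \<open>\<nu>\<close> indecomposable contains elements of every order in \<open>\<Gamma>\<close>, so it
  is \<open>A\<close>.
\<close>

lemma stable_if_scale_ind:
  assumes "c \<noteq> 0" and scale: "\<And>\<nu>. \<nu> \<in> ind \<Gamma> \<Longrightarrow> scale_x c (f \<nu>) = smult (c ^ \<nu>) (f \<nu>)"
    and "p \<in> A"
  shows "scale_x c p \<in> A"
proof -
  have order: "\<exists>p. p \<in> A \<and> scale_x c p \<in> A \<and> (\<forall>j<\<gamma>. coeff p j = 0) \<and> coeff p \<gamma> = 1" if "\<gamma> \<in> \<Gamma>" for \<gamma>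
    using that
  proof (induction \<gamma> rule: less_induct)
    case (less \<gamma>)
    show ?case
    proof (cases "\<gamma> \<in> ind \<Gamma>")
      case True
      have "scale_x c (f \<gamma>) \<in> A" using less.prems by (simp add: scale[OF True] smult_mem basis_mem)
      moreover have "coeff (f \<gamma>) j = 0" if "j < \<gamma>" for j
        using that by (intro coeff_basis_eq_0 less.prems) (auto simp: gaps_above_def)
      ultimately show ?thesis using less.prems basis_mem coeff_basis_self by blast
    next
      case False
      then obtain \<alpha> \<beta> where ab: "\<alpha> \<in> \<Gamma>" "\<beta> \<in> \<Gamma>" "\<gamma> = \<alpha> + \<beta>" using less.prems by (auto simp: ind_def)
      then have "\<alpha> < \<gamma>" "\<beta> < \<gamma>" by (auto simp: Gamma_of_def)
      obtain p where p: "p \<in> A" "scale_x c p \<in> A" "\<forall>j<\<alpha>. coeff p j = 0" "coeff p \<alpha> = 1"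
        using less.IH[OF \<open>\<alpha> < \<gamma>\<close> ab(1)] by blast
      obtain q where q: "q \<in> A" "scale_x c q \<in> A" "\<forall>j<\<beta>. coeff q j = 0" "coeff q \<beta> = 1"
        using less.IH[OF \<open>\<beta> < \<gamma>\<close> ab(2)] by blast
      \<comment> \<open>With the lowest powers of x factored out, the coefficient of p q at \<alpha>
        + \<beta> is the product of two constant terms.\<close>
      obtain p' q' where p': "p = monom 1 \<alpha> * p'" and q': "q = monom 1 \<beta> * q'"
        using p q by (metis monom_1_dvd_iff' dvdE)
      have "monom 1 \<gamma> = monom 1 \<alpha> * (monom 1 \<beta> :: 'a poly)" by (simp add: ab mult_monom)
      then have pq: "p * q = monom 1 \<gamma> * (p' * q')" by (simp only: p' q' mult_ac)
      have "coeff (p * q) \<gamma> = coeff p' 0 * coeff q' 0" by (simp add: pq coeff_monom_mult coeff_mult_0)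
      also have "\<dots> = 1" using p q by (simp add: p' q' coeff_monom_mult)
      finally have "coeff (p * q) \<gamma> = 1" .
      moreover have "\<forall>j<\<gamma>. coeff (p * q) j = 0" by (simp add: pq coeff_monom_mult)
      ultimately show ?thesis using p q by (auto simp: scale_x_mult mult_mem intro!: exI[of _ "p * q"])
    qed
  qed
  have "scale_x c p \<in> A" if "k \<le> m" "p \<in> A" "\<forall>j<k. coeff p j = 0" for k p
    using that
  proof (induction k arbitrary: p rule: inc_induct)
    case base
    then show ?case by (intro mem_if_low_coeffs_0) auto
  next
    case (step k)
    \<comment> \<open>The last condition says that \<open>coeff q k = 1\<close> unless
      \<open>coeff p k = 0\<close>; so q = 0 is allowed when nothing has to be subtracted, and q = 1
      serves k = 0, which is not in \<Gamma>.\<close>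
    have "\<exists>q. q \<in> A \<and> scale_x c q \<in> A \<and> (\<forall>j<k. coeff q j = 0) \<and> coeff p k = coeff p k * coeff q k"
    proof -
      consider "coeff p k = 0" | "k = 0" | "coeff p k \<noteq> 0" "1 \<le> k" by linarith
      then show ?thesis
      proof cases
        case 1
        then show ?thesis using one_mem diff_mem[OF one_mem one_mem] by (intro exI[of _ 0]) auto
      next
        case 2
        then show ?thesis using one_mem by (intro exI[of _ 1]) auto
      next
        case 3
        then have "k \<in> \<Gamma>" using step by (intro GammaI[of p]) auto
        then show ?thesis using order by fastforce
      qed
    qed
    then obtain q where q: "q \<in> A" "scale_x c q \<in> A" "\<forall>j<k. coeff q j = 0"
      "coeff p k = coeff p k * coeff q k" by blast
    let ?r = "p - smult (coeff p k) q"
    have "scale_x c ?r \<in> A"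
      using q step.prems by (intro step.IH diff_mem smult_mem) (auto simp: less_Suc_eq)
    then have "scale_x c ?r + smult (coeff p k) (scale_x c q) \<in> A" using q by (intro add_mem smult_mem)
    also have "scale_x c ?r + smult (coeff p k) (scale_x c q) = scale_x c p"
      by (simp flip: scale_x_smult scale_x_add)
    finally show ?case .
  qed
  from this[of 0 p] show ?thesis using \<open>p \<in> A\<close> by simp
qed

lemma restrict_scale_x_auto_if_ind:
  assumes "c \<noteq> 0" and ind: "c ^ fam_gcd (ind \<Gamma>) u = 1"
  shows "restrict (scale_x c) A \<in> poly_alg_auto A"
proof (rule restrict_scale_x_poly_alg_auto[OF \<open>c \<noteq> 0\<close> _ _ subalgebra])
  \<comment> \<open>Stated for every d because it is applied to c and to its inverse, which
    satisfies the same equation; together they make the restriction bijective.\<close>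
  have "scale_x d p \<in> A" if "p \<in> A" "d \<noteq> 0" "d ^ fam_gcd (ind \<Gamma>) u = 1" for d p
  proof (rule stable_if_scale_ind[OF \<open>d \<noteq> 0\<close> _ \<open>p \<in> A\<close>])
    fix \<nu> assume "\<nu> \<in> ind \<Gamma>"
    then have "scale_x d (u \<nu>) = u \<nu>" "\<nu> \<in> \<Gamma>"
      using that(3) scale_x_fixes_family_iff by (blast, simp add: ind_def)
    then show "scale_x d (f \<nu>) = smult (d ^ \<nu>) (f \<nu>)" using scale_basis_iff \<open>d \<noteq> 0\<close> by blast
  qed
  then show "scale_x c p \<in> A" "scale_x (inverse c) p \<in> A" if "p \<in> A" for p
    using assms that by (simp_all add: power_inverse)
qed

text \<open>Three conditions are linked in a circle: an automorphism fixes all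
  \<open>u \<gamma>\<close>, hence those with indecomposable index, and these suffice for an
  automorphism.\<close>

lemma
  assumes "c \<noteq> 0"
  shows power_fam_gcd_ind_eq_1_iff: "c ^ fam_gcd (ind \<Gamma>) u = 1 \<longleftrightarrow> c ^ fam_gcd \<Gamma> u = 1"
    and restrict_scale_x_auto_iff: "restrict (scale_x c) A \<in> poly_alg_auto A \<longleftrightarrow> c ^ fam_gcd \<Gamma> u = 1"
proof -
  let ?r = "restrict (scale_x c) A"
  have "c ^ fam_gcd \<Gamma> u = 1" if "?r \<in> poly_alg_auto A"
  proof -
    have maps: "?r \<in> A \<rightarrow> A"
      by (rule Bij_imp_funcset) (use that in \<open>simp add: poly_alg_auto_def\<close>)
    have "scale_x c p \<in> A" if "p \<in> A" for p using funcset_mem[OF maps that] that by simp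
    then have "scale_x c (u \<gamma>) = u \<gamma>" if "\<gamma> \<in> \<Gamma>" for \<gamma>
      using that scale_basis_if_stable scale_basis_iff assms by blast
    then show ?thesis by (simp flip: scale_x_fixes_family_iff)
  qed
  moreover have "c ^ fam_gcd (ind \<Gamma>) u = 1" if "c ^ fam_gcd \<Gamma> u = 1"
    using that by (auto simp: ind_def simp flip: scale_x_fixes_family_iff)
  ultimately show "c ^ fam_gcd (ind \<Gamma>) u = 1 \<longleftrightarrow> c ^ fam_gcd \<Gamma> u = 1"
    "?r \<in> poly_alg_auto A \<longleftrightarrow> c ^ fam_gcd \<Gamma> u = 1"
    using restrict_scale_x_auto_if_ind[OF assms] by blast+
qed

section \<open>The automorphism group as a group of roots of unity\<close>

lemma carrier_Aut_alg:
  "carrier (Aut_alg A) = {restrict (scale_x c) A | c. c \<noteq> 0 \<and> c ^ fam_gcd \<Gamma> u = 1}"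
  using automorphism_eq_scale_x restrict_scale_x_auto_iff
  by (auto simp: Aut_alg_def)

lemma Aut_alg_pow:
  assumes "restrict (scale_x c) A \<in> carrier (Aut_alg A)"
  shows "restrict (scale_x c) A [^]\<^bsub>Aut_alg A\<^esub> k = restrict (scale_x (c ^ k)) A"
proof -
  interpret group "Aut_alg A" by (rule group_Aut)
  show ?thesis
  proof (induction k)
    case 0
    show ?case by (simp only: nat_pow_0 power_0 one_Aut_alg)
  next
    case (Suc k)
    have "restrict (scale_x (c ^ k)) A \<in> carrier (Aut_alg A)"
      using nat_pow_closed[OF assms, of k] by (simp only: Suc)
    then show ?case using assms by (simp only: nat_pow_Suc Suc mult_Aut_alg power_Suc2)
  qed
qed

text \<open>Replacing the gcd by n keeps the solutions of the equation and makes the exponent prime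
  to the characteristic, so that there are exactly n of them, all powers of one.\<close>

lemma Aut_alg_cyclic:
  fixes n defines "n \<equiv> coprime_part CHAR('a) (fam_gcd \<Gamma> u)"
  assumes "fam_gcd \<Gamma> u > 0"
  shows "cyclic_group (Aut_alg A)" and "order (Aut_alg A) = n"
    and "\<exists>c::'a. primitive_unity_root n c"
    and "\<And>c. primitive_unity_root n c \<Longrightarrow> restrict (scale_x c) A \<in> carrier (Aut_alg A)"
    and "\<And>c. primitive_unity_root n c \<Longrightarrow>
      carrier (Aut_alg A) = generate (Aut_alg A) {restrict (scale_x c) A}"
proof -
  interpret group "Aut_alg A" by (rule group_Aut)
  have "CHAR('a) \<noteq> 1" using CHAR_0_or_prime[where ?'a='a] by auto
  have "n > 0" unfolding n_def using assms coprime_part_eq_0_iff gr0I by (metis less_irrefl)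
  moreover have "\<not> CHAR('a) dvd n"
    unfolding n_def using assms(2) \<open>CHAR('a) \<noteq> 1\<close> by (rule not_dvd_coprime_part)
  ultimately show ex: "\<exists>c::'a. primitive_unity_root n c" by (rule ex_primitive_unity_root)
  have "c \<noteq> 0" if "c ^ n = 1" for c :: 'a using that \<open>n > 0\<close> by (auto simp: power_0_left)
  then have carrier: "carrier (Aut_alg A) = (\<lambda>c. restrict (scale_x c) A) ` {c. c ^ n = 1}"
    unfolding carrier_Aut_alg n_def power_coprime_part_eq_1_iff by blast
  have "order (Aut_alg A) = card {c::'a. c ^ n = 1}"
    unfolding Coset.order_def carrier by (intro card_image inj_on_subset[OF inj_restrict_scale_x]) simp
  then show "order (Aut_alg A) = n" using ex card_roots_of_unity by auto
  show mem: "restrict (scale_x c) A \<in> carrier (Aut_alg A)" if "primitive_unity_root n c" for c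
    using that unfolding carrier by (auto simp: primitive_unity_root_def)
  show gen: "carrier (Aut_alg A) = generate (Aut_alg A) {restrict (scale_x c) A}"
    if c: "primitive_unity_root n c" for c
  proof (rule antisym)
    show "generate (Aut_alg A) {restrict (scale_x c) A} \<subseteq> carrier (Aut_alg A)"
      using mem[OF c] by (intro generate_incl) simp
    show "carrier (Aut_alg A) \<subseteq> generate (Aut_alg A) {restrict (scale_x c) A}"
    proof
      fix \<phi> assume "\<phi> \<in> carrier (Aut_alg A)"
      then obtain k where "\<phi> = restrict (scale_x (c ^ k)) A"
        unfolding carrier roots_of_unity_eq_powers[OF c] by blast
      then have "\<phi> = restrict (scale_x c) A [^]\<^bsub>Aut_alg A\<^esub> int k"
        using Aut_alg_pow[OF mem[OF c], of k] by (simp add: int_pow_int)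
      then show "\<phi> \<in> generate (Aut_alg A) {restrict (scale_x c) A}"
        unfolding generate_pow[OF mem[OF c]] by blast
    qed
  qed
  obtain c :: 'a where c: "primitive_unity_root n c" using ex by blast
  have "carrier (Aut_alg A) = range (\<lambda>k::int. restrict (scale_x c) A [^]\<^bsub>Aut_alg A\<^esub> k)"
    unfolding gen[OF c] generate_pow[OF mem[OF c]] by blast
  then show "cyclic_group (Aut_alg A)" using mem[OF c] cyclic_group by blast
qed

text \<open>A positive exponent cannot send every non-zero element of the field to 1.\<close>

lemma Aut_alg_eq_all_scalings_iff:
  "carrier (Aut_alg A) = {restrict (scale_x c) A | c. c \<noteq> 0} \<longleftrightarrow> fam_gcd \<Gamma> u = 0"
proof
  assume all: "carrier (Aut_alg A) = {restrict (scale_x c) A | c. c \<noteq> 0}"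
  have "c ^ fam_gcd \<Gamma> u = 1" if "c \<noteq> 0" for c :: 'a
  proof -
    have "restrict (scale_x c) A \<in> carrier (Aut_alg A)" using that unfolding all by blast
    then show ?thesis using restrict_scale_x_auto_iff[OF that] by (simp add: Aut_alg_def)
  qed
  then show "fam_gcd \<Gamma> u = 0" using ex_power_neq_1[of "fam_gcd \<Gamma> u", where ?'a = 'a] by blast
qed (simp add: carrier_Aut_alg)

lemma Aut_alg_trivial_iff:
  "carrier (Aut_alg A) = {\<one>\<^bsub>Aut_alg A\<^esub>} \<longleftrightarrow> coprime_part CHAR('a) (fam_gcd \<Gamma> u) = 1"
proof (cases "fam_gcd \<Gamma> u = 0")
  case True
  \<comment> \<open>For gcd 0 every scaling is an automorphism; an element other than 0 and 1 gives
    a non-trivial one.\<close>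
  obtain c :: 'a where "c \<noteq> 0" "c \<noteq> 1" using ex_power_neq_1[of 1] by auto
  then have "restrict (scale_x c) A \<in> carrier (Aut_alg A)" "restrict (scale_x c) A \<noteq> \<one>\<^bsub>Aut_alg A\<^esub>"
    using True inj_restrict_scale_x by (auto simp: carrier_Aut_alg one_Aut_alg dest: injD)
  then show ?thesis using True by auto
next
  case False
  interpret group "Aut_alg A" by (rule group_Aut)
  have "carrier (Aut_alg A) = {\<one>\<^bsub>Aut_alg A\<^esub>} \<longleftrightarrow> order (Aut_alg A) = 1"
    by (metis Coset.order_def One_nat_def card_1_singleton_iff one_closed singletonD)
  then show ?thesis using False Aut_alg_cyclic(2) by simp
qed

lemma fam_gcd_eq_0_iff: "fam_gcd \<Gamma> u = 0 \<longleftrightarrow> (\<forall>\<gamma>\<in>\<Gamma>. f \<gamma> = monom 1 \<gamma>)"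
  by (auto simp: fam_gcd_def Gcd_0_iff basis_eq_monom_iff)

end

theorem theorem3p4:
  fixes A :: "'a::alg_closed_field poly set"
    and m n :: nat and \<Gamma> :: "nat set"
    and f u :: "nat \<Rightarrow> 'a poly"
  assumes m: "m \<ge> 2"
    and A: "A \<in> algs_of m \<Gamma>"
    and f: "canonical_basis m A f"
    and u: "\<forall>\<gamma>\<in>\<Gamma>. f \<gamma> = monom 1 \<gamma> * u \<gamma>"
    and n: "n = (if CHAR('a) = 0 then fam_gcd \<Gamma> u else coprime_part CHAR('a) (fam_gcd \<Gamma> u))"
  shows
    "(carrier (Aut_alg A) =
        {restrict (scale_x c) A | c. c \<noteq> 0 \<and> (\<forall>\<gamma>\<in>\<Gamma>. scale_x c (f \<gamma>) = smult (c ^ \<gamma>) (f \<gamma>))} \<and>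
      carrier (Aut_alg A) =
        {restrict (scale_x c) A | c. c \<noteq> 0 \<and> (\<forall>\<gamma>\<in>\<Gamma>. scale_x c (u \<gamma>) = u \<gamma>)}) \<and>
     (carrier (Aut_alg A) = {restrict (scale_x c) A | c. c \<noteq> 0} \<longleftrightarrow>
        (\<forall>\<gamma>\<in>\<Gamma>. f \<gamma> = monom 1 \<gamma>)) \<and>
     ((\<exists>\<gamma>\<in>\<Gamma>. f \<gamma> \<noteq> monom 1 \<gamma>) \<longrightarrow>
        cyclic_group (Aut_alg A) \<and> order (Aut_alg A) = n \<and>
        (\<exists>c::'a. primitive_unity_root n c) \<and>
        (\<forall>c::'a. primitive_unity_root n c \<longrightarrow>
           restrict (scale_x c) A \<in> carrier (Aut_alg A) \<and>
           carrier (Aut_alg A) = generate (Aut_alg A) {restrict (scale_x c) A}) \<and>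
        (CHAR('a) = 0 \<longrightarrow> fam_gcd \<Gamma> u = fam_gcd (ind \<Gamma>) u) \<and>
        (CHAR('a) > 0 \<longrightarrow>
           coprime_part CHAR('a) (fam_gcd \<Gamma> u) = fam_gcd_p CHAR('a) (ind \<Gamma>) u)) \<and>
     (carrier (Aut_alg A) = {\<one>\<^bsub>Aut_alg A\<^esub>} \<longleftrightarrow>
        (if CHAR('a) = 0 then fam_gcd \<Gamma> u = 1 else fam_gcd_p CHAR('a) \<Gamma> u = 1))"
proof -
  have \<Gamma>: "\<Gamma> = Gamma_of m A" and "A \<in> algs m" using A by (auto simp: algs_of_def)
  interpret canonical_basis_alg m A f u
    using m \<open>A \<in> algs m\<close> f u by unfold_locales (simp_all add: \<Gamma>)
  \<comment> \<open>\<open>coprime_part 0\<close> is the identity, so both characteristics are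
    treated at once.\<close>
  have n: "n = coprime_part CHAR('a) (fam_gcd (Gamma_of m A) u)" using n by (simp add: \<Gamma>)
  have p: "fam_gcd_p CHAR('a) I u = coprime_part CHAR('a) (fam_gcd I u)" for I
    by (rule fam_gcd_p_eq[OF CHAR_0_or_prime])
  have carrier_u: "carrier (Aut_alg A) =
      {restrict (scale_x c) A | c. c \<noteq> 0 \<and> (\<forall>\<gamma>\<in>Gamma_of m A. scale_x c (u \<gamma>) = u \<gamma>)}"
    unfolding carrier_Aut_alg scale_x_fixes_family_iff ..
  also have "\<dots> = {restrict (scale_x c) A | c.
      c \<noteq> 0 \<and> (\<forall>\<gamma>\<in>Gamma_of m A. scale_x c (f \<gamma>) = smult (c ^ \<gamma>) (f \<gamma>))}"
    using scale_basis_iff by blast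
  finally have carrier_f: "carrier (Aut_alg A) = {restrict (scale_x c) A | c.
      c \<noteq> 0 \<and> (\<forall>\<gamma>\<in>Gamma_of m A. scale_x c (f \<gamma>) = smult (c ^ \<gamma>) (f \<gamma>))}" .
  \<comment> \<open>The two gcds have the same roots of unity, which determines them up to powers of
    the characteristic.\<close>
  have ind: "coprime_part CHAR('a) (fam_gcd (Gamma_of m A) u) =
      coprime_part CHAR('a) (fam_gcd (ind (Gamma_of m A)) u)"
    by (rule coprime_part_eqI) (simp add: power_fam_gcd_ind_eq_1_iff)
  have all: "carrier (Aut_alg A) = {restrict (scale_x c) A | c. c \<noteq> 0} \<longleftrightarrow>
      (\<forall>\<gamma>\<in>Gamma_of m A. f \<gamma> = monom 1 \<gamma>)"
    unfolding Aut_alg_eq_all_scalings_iff fam_gcd_eq_0_iff ..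
  have cyclic: "(\<exists>\<gamma>\<in>Gamma_of m A. f \<gamma> \<noteq> monom 1 \<gamma>) \<longrightarrow>
      cyclic_group (Aut_alg A) \<and> order (Aut_alg A) = n \<and>
      (\<exists>c::'a. primitive_unity_root n c) \<and>
      (\<forall>c::'a. primitive_unity_root n c \<longrightarrow>
         restrict (scale_x c) A \<in> carrier (Aut_alg A) \<and>
         carrier (Aut_alg A) = generate (Aut_alg A) {restrict (scale_x c) A}) \<and>
      (CHAR('a) = 0 \<longrightarrow> fam_gcd (Gamma_of m A) u = fam_gcd (ind (Gamma_of m A)) u) \<and>
      (CHAR('a) > 0 \<longrightarrow>
         coprime_part CHAR('a) (fam_gcd (Gamma_of m A) u) = fam_gcd_p CHAR('a) (ind (Gamma_of m A)) u)"
    (is "_ \<longrightarrow> ?R")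
  proof
    assume "\<exists>\<gamma>\<in>Gamma_of m A. f \<gamma> \<noteq> monom 1 \<gamma>"
    then have pos: "fam_gcd (Gamma_of m A) u > 0" using fam_gcd_eq_0_iff gr0I by metis
    show ?R
      unfolding n p
    proof (intro conjI allI impI)
      show "fam_gcd (Gamma_of m A) u = fam_gcd (ind (Gamma_of m A)) u" if "CHAR('a) = 0"
        using ind that by simp
    qed (rule ind Aut_alg_cyclic[OF pos]; assumption?)+
  qed
  have trivial: "carrier (Aut_alg A) = {\<one>\<^bsub>Aut_alg A\<^esub>} \<longleftrightarrow>
      (if CHAR('a) = 0 then fam_gcd (Gamma_of m A) u = 1 else fam_gcd_p CHAR('a) (Gamma_of m A) u = 1)"
    unfolding p Aut_alg_trivial_iff by simp
  show ?thesis
    unfolding \<Gamma> by (intro conjI carrier_f carrier_u all cyclic trivial)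
qed

end
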